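(* (Euler Beta formula on non-uniform lattices.) Let $x$ be a non-uniform lattice, let $\alpha,\beta\in\mathbb{C}$, and let $a,z\in\mathbb{C}$ with $z-a$ a positive integer. Then $$\sum_{t=a+1}^{z}\frac{[x_{\beta}(z)-x_{\beta}(t-1)]^{(\beta-1)}}{[\Gamma(\beta)]_q}\cdot\frac{[x(t)-x(a)]^{(\alpha)}}{[\Gamma(\alpha+1)]_q}\,\nabla x_{1}(t)=\frac{[x_{\beta}(z)-x_{\beta}(a)]^{(\alpha+\beta)}}{[\Gamma(\alpha+\beta+1)]_q},$$ where the sum is over $t=a+1,a+2,\dots,z$.
   Context: Non-uniform lattice: a function $x:\mathbb{C}\to\mathbb{C}$ of one of the two forms (Q) $x(s)=\tilde c_1s^2+\tilde c_2s+\tilde c_3$ with $\tilde c_1\tilde c_2\neq0$, or (q) $x(s)=c_1q^{s}+c_2q^{-s}+c_3$ with $c_1c_2\ne0$, where $q\in\mathbb{C}\setminus\{0\}$, $|q|\neq1$, a value of $\log q$ is fixed and $q^s=e^{s\log q}$. For $\nu\in\mathbb{C}$, $x_\nu(s)=x(s+\nu/2)$. $\nabla F(s)=F(s)-F(s-1)$, so $\nabla x_1(t)=x_1(t)-x_1(t-1)$. Gamma functions: in case (Q), $[\Gamma(\alpha)]_q=\Gamma(\alpha)$ (Euler's Gamma function). In case (q), $[\Gamma(\alpha)]_q=q^{-(\alpha-1)(\alpha-2)/4}\Gamma_q(\alpha)$, where $\Gamma_q(s)=\frac{\prod_{k\ge0}(1-q^{k+1})}{(1-q)^{s-1}\prod_{k\ge0}(1-q^{s+k})}$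 for $|q|<1$ and $\Gamma_q(s)=q^{(s-1)(s-2)/2}\Gamma_{1/q}(s)$ for $|q|>1$. Generalized powers: for $S,Z,\mu\in\mathbb{C}$, in case (Q) with $c=\tilde c_2/\tilde c_1$, $$[x(S)-x(Z)]^{(\mu)}=\tilde c_1^{\,\mu}\frac{\Gamma(S-Z+\mu)\Gamma(S+Z+c+1)}{\Gamma(S-Z)\Gamma(S+Z-\mu+c+1)};$$ in case (q) with $c=\log(c_1/c_2)/\log q$, $$[x(S)-x(Z)]^{(\mu)}=[c_2(1-q)^2]^{\mu}q^{-\mu S}\frac{\Gamma_q(S-Z+\mu)\Gamma_q(S+Z+c+1)}{\Gamma_q(S-Z)\Gamma_q(S+Z-\mu+c+1)}.$$ $[x_\nu(s)-x_\rho(t)]^{(\mu)}$ means this expression with $S=s+\nu/2$, $Z=t+\rho/2$. (For a nonnegative integer $n$ it equals $\prod_{k=0}^{n-1}[x(S)-x(Z-k)]$.) Complex powers of constants are taken with fixed choices of logarithms; $1/\Gamma$ and $1/\Gamma_q$ are $0$ at poles. Convention: the identity is asserted for parameter values for which all ($q$-)Gamma values occurring in numerators are finite. *)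

theory Defs
  imports "HOL-Analysis.Analysis"
begin

text \<open>
  A non-uniform lattice is given by the data entering its formula together with the
  choices of logarithms that occur in the complex powers:
  \<^item> \<open>Quad c1 c2 c3 l\<close> is $x(s) = c_1 s^2 + c_2 s + c_3$, where \<open>l\<close> is a value of $\log c_1$;
  \<^item> \<open>Expo c1 c2 c3 q lq lc lp lr\<close> is $x(s) = c_1 q^s + c_2 q^{-s} + c_3$, where \<open>lq\<close>, \<open>lc\<close>
    and \<open>lp\<close> are values of $\log q$, $\log (c_1/c_2)$ and $\log (c_2 (1-q)^2)$, and \<open>lr\<close> is a
    value of $\log (1-r)$, with $r = q$ if $|q| < 1$ and $r = 1/q$ if $|q| > 1$; this is the
    logarithm needed for $(1-r)^{s-1}$ in the $q$-Gamma function.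

  The powers themselves are written \<open>exp (s * l)\<close>, so that every branch is covered and not
  only the principal one used by \<open>powr\<close>.
\<close>

datatype lattice =
    Quad complex complex complex complex
  | Expo complex complex complex complex complex complex complex complex

fun nonuniform_lattice :: "lattice \<Rightarrow> bool" where
  "nonuniform_lattice (Quad c1 c2 c3 l) \<longleftrightarrow> c1 * c2 \<noteq> 0 \<and> exp l = c1"
| "nonuniform_lattice (Expo c1 c2 c3 q lq lc lp lr) \<longleftrightarrow>
     c1 * c2 \<noteq> 0 \<and> q \<noteq> 0 \<and> norm q \<noteq> 1 \<and>
     exp lq = q \<and> exp lc = c1 / c2 \<and> exp lp = c2 * (1 - q)\<^sup>2 \<and>
     exp lr = 1 - (if norm q < 1 then q else 1 / q)"

fun lattice_fun :: "lattice \<Rightarrow> complex \<Rightarrow> complex" where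
  "lattice_fun (Quad c1 c2 c3 l) s = c1 * s\<^sup>2 + c2 * s + c3"
| "lattice_fun (Expo c1 c2 c3 q lq lc lp lr) s = c1 * exp (s * lq) + c2 * exp (- s * lq) + c3"

definition shifted :: "lattice \<Rightarrow> complex \<Rightarrow> complex \<Rightarrow> complex" where
  "shifted X \<nu> s = lattice_fun X (s + \<nu> / 2)"

definition nabla :: "(complex \<Rightarrow> complex) \<Rightarrow> complex \<Rightarrow> complex" where
  "nabla F s = F s - F (s - 1)"

text \<open>
  The $q$-Gamma function for $|q| < 1$, with \<open>lq\<close> and \<open>lr\<close> the chosen values of $\log q$ and
  $\log (1-q)$. At a pole some factor of the product in the denominator vanishes, so the
  value is $0$ and division by it also yields $0$, as required for $1/\Gamma_q$. The library's
  \<open>Gamma\<close> behaves in the same way.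
\<close>

definition qGamma_inner :: "complex \<Rightarrow> complex \<Rightarrow> complex \<Rightarrow> complex" where
  "qGamma_inner lq lr s =
     (\<Prod>k. 1 - exp (of_nat (k + 1) * lq)) /
     (exp ((s - 1) * lr) * (\<Prod>k. 1 - exp ((s + of_nat k) * lq)))"

text \<open>For $|q| > 1$ the value of $\log (1/q)$ is $-\log q$, so that $(1/q)^s = q^{-s}$.\<close>

definition qGamma :: "complex \<Rightarrow> complex \<Rightarrow> complex \<Rightarrow> complex" where
  "qGamma lq lr s =
     (if norm (exp lq) < 1 then qGamma_inner lq lr s
      else exp ((s - 1) * (s - 2) / 2 * lq) * qGamma_inner (- lq) lr s)"

fun bracket_Gamma :: "lattice \<Rightarrow> complex \<Rightarrow> complex" where
  "bracket_Gamma (Quad c1 c2 c3 l) \<alpha> = Gamma \<alpha>"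
| "bracket_Gamma (Expo c1 c2 c3 q lq lc lp lr) \<alpha> =
     exp (- ((\<alpha> - 1) * (\<alpha> - 2) / 4) * lq) * qGamma lq lr \<alpha>"

fun lattice_c :: "lattice \<Rightarrow> complex" where
  "lattice_c (Quad c1 c2 c3 l) = c2 / c1"
| "lattice_c (Expo c1 c2 c3 q lq lc lp lr) = lc / lq"

text \<open>\<open>gen_power X S Z \<mu>\<close> is $[x(S) - x(Z)]^{(\mu)}$.\<close>

fun gen_power :: "lattice \<Rightarrow> complex \<Rightarrow> complex \<Rightarrow> complex \<Rightarrow> complex" where
  "gen_power (Quad c1 c2 c3 l) S Z \<mu> =
     (let c = lattice_c (Quad c1 c2 c3 l) in
      exp (\<mu> * l) *
      ((Gamma (S - Z + \<mu>) * Gamma (S + Z + c + 1)) /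
       (Gamma (S - Z) * Gamma (S + Z - \<mu> + c + 1))))"
| "gen_power (Expo c1 c2 c3 q lq lc lp lr) S Z \<mu> =
     (let c = lattice_c (Expo c1 c2 c3 q lq lc lp lr) in
      exp (\<mu> * lp) * exp (- \<mu> * S * lq) *
      ((qGamma lq lr (S - Z + \<mu>) * qGamma lq lr (S + Z + c + 1)) /
       (qGamma lq lr (S - Z) * qGamma lq lr (S + Z - \<mu> + c + 1))))"

text \<open>\<open>shifted_power X \<nu> s \<rho> t \<mu>\<close> is $[x_\nu(s) - x_\rho(t)]^{(\mu)}$.\<close>

definition shifted_power ::
    "lattice \<Rightarrow> complex \<Rightarrow> complex \<Rightarrow> complex \<Rightarrow> complex \<Rightarrow> complex \<Rightarrow> complex" where
  "shifted_power X \<nu> s \<rho> t \<mu> = gen_power X (s + \<nu> / 2) (t + \<rho> / 2) \<mu>"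

text \<open>
  Finiteness of $\Gamma(s)$ and $\Gamma_q(s)$. For both $|q| < 1$ and $|q| > 1$ the poles of
  $\Gamma_q$ are the points with $q^{s+k} = 1$ for some $k \geq 0$.
\<close>

fun Gamma_finite :: "lattice \<Rightarrow> complex \<Rightarrow> bool" where
  "Gamma_finite (Quad c1 c2 c3 l) s \<longleftrightarrow> s \<notin> \<int>\<^sub>\<le>\<^sub>0"
| "Gamma_finite (Expo c1 c2 c3 q lq lc lp lr) s \<longleftrightarrow> (\<forall>k::nat. exp ((s + of_nat k) * lq) \<noteq> 1)"

text \<open>Both Gamma values in the numerator of $[x_\nu(s) - x_\rho(t)]^{(\mu)}$ are finite.\<close>

definition power_finite ::
    "lattice \<Rightarrow> complex \<Rightarrow> complex \<Rightarrow> complex \<Rightarrow> complex \<Rightarrow> complex \<Rightarrow> bool" where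
  "power_finite X \<nu> s \<rho> t \<mu> \<longleftrightarrow>
     (let S = s + \<nu> / 2; Z = t + \<rho> / 2 in
      Gamma_finite X (S - Z + \<mu>) \<and> Gamma_finite X (S + Z + lattice_c X + 1))"

end

theory Submission
  imports Defs
begin

text \<open>
  Put $[s] = s$ on a quadratic lattice and
  $[s] = (q^{s/2} - q^{-s/2}) / (q^{1/2} - q^{-1/2})$ on a $q$-lattice. Then
  $[\Gamma(s+1)]_q = [s]\,[\Gamma(s)]_q$, a generalized power is $C^\mu$ times a quotient of values
  of $[\Gamma]_q$, and $\nabla x_1(t) = C\,[2t + c]$ with the same constant $C$. After division by
  the right-hand side's Gamma values the formula becomes the terminating very-well-poised sum
  (${}_5F_4$, respectively ${}_6\phi_5$), which is proved for both lattices at once by the WZ method: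
  the only property of the bracket that the certificate needs is a four-term addition formula.
\<close>

section \<open>Bracket functions and the terminating very-well-poised sum\<close>

locale bracket =
  fixes b :: "complex \<Rightarrow> complex"
  assumes b_0 [simp]: "b 0 = 0"
    and b_of_nat_nonzero: "k > 0 \<Longrightarrow> b (of_nat k) \<noteq> 0"
    and b_addition: "b (m + 1) * b (\<gamma> - m - 1) * b (A + m - \<alpha>) * b (A + 2 * j)
          - b (\<alpha> + \<gamma> - m) * b (A + 2 * j) * b (m + 1 - j) * b (A + j + m + 1)
        = b j * b (A + j + m + 1) * b (\<gamma> - j) * b (A + j - 1 - \<alpha>)
          - b (A + \<gamma> + j) * b (\<alpha> + 1 + j) * b (m + 1 - j) * b (A + j)"
begin

definition poch :: "complex \<Rightarrow> nat \<Rightarrow> complex" where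
  "poch s m = (\<Prod>i<m. b (s + of_nat i))"

lemma poch_0 [simp]: "poch s 0 = 1"
  by (simp add: poch_def)

lemma poch_Suc: "poch s (Suc m) = poch s m * b (s + of_nat m)"
  by (simp add: poch_def)

lemma poch_Suc_left: "poch s (Suc m) = b s * poch (s + 1) m"
  by (simp add: poch_def prod.lessThan_Suc_shift algebra_simps del: prod.lessThan_Suc)

lemma poch_nonzero: "(\<And>i. i < m \<Longrightarrow> b (s + of_nat i) \<noteq> 0) \<Longrightarrow> poch s m \<noteq> 0"
  by (simp add: poch_def)

lemma poch_1_nonzero [simp]: "poch 1 m \<noteq> 0"
proof (rule poch_nonzero)
  show "b (1 + of_nat i) \<noteq> 0" for i
    using b_of_nat_nonzero[of "Suc i"] by simp
qed

text \<open>
  The sum over \<open>j\<close> is the very-well-poised one with base parameter \<open>A\<close>. Keeping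
  \<open>\<gamma> = \<beta> + m\<close> rather than \<open>\<beta>\<close> fixed in the recursion on \<open>m\<close> is what makes the certificate a
  single product.
\<close>

definition wp_term :: "complex \<Rightarrow> complex \<Rightarrow> complex \<Rightarrow> nat \<Rightarrow> nat \<Rightarrow> complex" where
  "wp_term A \<alpha> \<gamma> m j =
     poch (\<gamma> - of_nat m) (m - j) * poch (A + \<gamma>) j * poch (\<alpha> + 1) j *
     poch (A + of_nat j - \<alpha>) (m - j) * b (A + 2 * of_nat j) /
     (poch 1 (m - j) * poch 1 j * poch (A + of_nat j) (Suc m))"

text \<open>The WZ mate of \<open>wp_term\<close>. The factor \<open>b (of_nat j)\<close> makes it
  vanish at j = 0, so a telescoping sum over j leaves only the upper boundary value.\<close>

definition wp_cert :: "complex \<Rightarrow> complex \<Rightarrow> complex \<Rightarrow> nat \<Rightarrow> nat \<Rightarrow> complex" where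
  "wp_cert A \<alpha> \<gamma> m j =
     - (poch (\<gamma> - of_nat m) (Suc m - j) * poch (A + \<gamma>) j * poch (\<alpha> + 1) j *
        poch (A + of_nat j - 1 - \<alpha>) (Suc m - j) * b (of_nat j)) /
     (poch 1 (Suc m - j) * poch 1 j * poch (A + of_nat j) (Suc m))"

text \<open>All four quantities share one product of shifted factorials. Once it is pulled out, the
  claim is exactly \<open>b_addition\<close> with m and j read as complex numbers.\<close>

lemma wp_cert_step:
  assumes A: "\<And>i::nat. b (A + of_nat i) \<noteq> 0" and "j \<le> m"
  shows "b (of_nat m + 1) * wp_term A \<alpha> \<gamma> (Suc m) j - b (\<alpha> + \<gamma> - of_nat m) * wp_term A \<alpha> \<gamma> m j
       = wp_cert A \<alpha> \<gamma> m (Suc j) - wp_cert A \<alpha> \<gamma> m j"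
proof -
  \<comment> \<open>Writing m = j + d removes the truncated subtractions; Suc m - j becomes Suc
    d.\<close>
  obtain d where m: "m = j + d" using \<open>j \<le> m\<close> le_Suc_ex by blast
  define g where "g = poch (\<gamma> - of_nat m) d"
  define h where "h = poch (A + \<gamma>) j * poch (\<alpha> + 1) j"
  define r where "r = poch (A + of_nat j - \<alpha>) d"
  define e where "e = poch 1 d * poch 1 j"
  \<comment> \<open>The common core of the denominators: \<open>poch (A + of_nat j)\<close> adds a
    factor on its left, \<open>poch (A + of_nat (Suc j))\<close> one on its right, and passing to
    Suc m in the term adds the right-hand factor as well.\<close>
  define w where "w = poch (A + of_nat j + 1) m"
  have w: "w \<noteq> 0" unfolding w_def
    by (rule poch_nonzero) (metis A add.assoc of_nat_1 of_nat_add)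
  have e: "e \<noteq> 0" unfolding e_def by simp
  have nz: "b (of_nat m + 1 - of_nat j) \<noteq> 0" "b (1 + of_nat j) \<noteq> 0" "b (A + of_nat j) \<noteq> 0"
    "b (A + of_nat j + of_nat m + 1) \<noteq> 0"
    using b_of_nat_nonzero[of "Suc d"] b_of_nat_nonzero[of "Suc j"] A[of j] A[of "Suc (j + m)"]
    by (simp_all add: m algebra_simps)
  have 1: "wp_term A \<alpha> \<gamma> (Suc m) j =
     (b (\<gamma> - of_nat m - 1) * g) * h * (r * b (A + of_nat m - \<alpha>)) * b (A + 2 * of_nat j) /
     (e * b (of_nat m + 1 - of_nat j) * (b (A + of_nat j) * w * b (A + of_nat j + of_nat m + 1)))"
  proof -
    have "poch (\<gamma> - of_nat (Suc m)) (Suc m - j) = b (\<gamma> - of_nat m - 1) * g"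
      by (simp add: g_def m Suc_diff_le poch_Suc_left algebra_simps)
    moreover have "poch (A + of_nat j - \<alpha>) (Suc m - j) = r * b (A + of_nat m - \<alpha>)"
      by (simp add: r_def m Suc_diff_le poch_Suc algebra_simps)
    moreover have "poch 1 (Suc m - j) = poch 1 d * b (of_nat m + 1 - of_nat j)"
      by (simp add: m Suc_diff_le poch_Suc algebra_simps)
    moreover have "poch (A + of_nat j) (Suc (Suc m)) = b (A + of_nat j) * w * b (A + of_nat j + of_nat m + 1)"
      by (simp add: w_def poch_Suc_left[of _ "Suc m"] poch_Suc[of _ m] algebra_simps)
    ultimately show ?thesis
      by (simp only: wp_term_def h_def e_def ac_simps)
  qed
  have 2: "wp_term A \<alpha> \<gamma> m j = g * h * r * b (A + 2 * of_nat j) / (e * (b (A + of_nat j) * w))"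
    by (simp add: wp_term_def g_def h_def r_def e_def w_def m poch_Suc_left)
  have 3: "wp_cert A \<alpha> \<gamma> m j =
     - (g * b (\<gamma> - of_nat j) * h * (b (A + of_nat j - 1 - \<alpha>) * r) * b (of_nat j)) /
     (e * b (of_nat m + 1 - of_nat j) * (b (A + of_nat j) * w))"
  proof -
    have "poch (\<gamma> - of_nat m) (Suc m - j) = g * b (\<gamma> - of_nat j)"
      by (simp add: g_def m Suc_diff_le poch_Suc)
    moreover have "poch (A + of_nat j - 1 - \<alpha>) (Suc m - j) = b (A + of_nat j - 1 - \<alpha>) * r"
      by (simp add: r_def m Suc_diff_le poch_Suc_left add_diff_eq)
    moreover have "poch 1 (Suc m - j) = poch 1 d * b (of_nat m + 1 - of_nat j)"
      by (simp add: m Suc_diff_le poch_Suc algebra_simps)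
    ultimately show ?thesis
      by (simp only: wp_cert_def h_def e_def w_def poch_Suc_left[of _ m] mult_ac)
  qed
  have 4: "wp_cert A \<alpha> \<gamma> m (Suc j) =
     - (g * (h * b (A + \<gamma> + of_nat j) * b (\<alpha> + 1 + of_nat j)) * r) /
     (e * (w * b (A + of_nat j + of_nat m + 1)))"
  proof -
    have "poch (A + of_nat (Suc j)) (Suc m) = w * b (A + of_nat j + of_nat m + 1)"
      by (simp add: w_def poch_Suc algebra_simps)
    moreover have "poch (A + of_nat (Suc j) - 1 - \<alpha>) (Suc m - Suc j) = r"
      by (simp add: r_def m algebra_simps)
    moreover have "poch (A + \<gamma>) (Suc j) * poch (\<alpha> + 1) (Suc j) =
        h * b (A + \<gamma> + of_nat j) * b (\<alpha> + 1 + of_nat j)"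
      by (simp add: h_def poch_Suc)
    moreover have "poch 1 (Suc m - Suc j) * poch 1 (Suc j) = e * b (1 + of_nat j)"
      by (simp add: e_def m poch_Suc)
    moreover have "poch (\<gamma> - of_nat m) (Suc m - Suc j) = g"
      by (simp add: g_def m)
    ultimately have "wp_cert A \<alpha> \<gamma> m (Suc j) =
       - (g * (h * b (A + \<gamma> + of_nat j) * b (\<alpha> + 1 + of_nat j)) * r * b (of_nat (Suc j))) /
       (e * b (1 + of_nat j) * (w * b (A + of_nat j + of_nat m + 1)))"
      unfolding wp_cert_def by (simp only: mult.assoc[of _ "poch (A + \<gamma>) (Suc j)"])
    \<comment> \<open>The factor b (j + 1) of the certificate cancels the new factor of
      \<open>poch 1 (Suc j)\<close>.\<close>
    then show ?thesis using nz(2) by simp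
  qed
  have "b (of_nat m + 1) * wp_term A \<alpha> \<gamma> (Suc m) j - b (\<alpha> + \<gamma> - of_nat m) * wp_term A \<alpha> \<gamma> m j
     = g * h * r / (e * w * b (of_nat m + 1 - of_nat j) * b (A + of_nat j) * b (A + of_nat j + of_nat m + 1)) *
       (b (of_nat m + 1) * b (\<gamma> - of_nat m - 1) * b (A + of_nat m - \<alpha>) * b (A + 2 * of_nat j)
          - b (\<alpha> + \<gamma> - of_nat m) * b (A + 2 * of_nat j) * b (of_nat m + 1 - of_nat j) * b (A + of_nat j + of_nat m + 1))"
    unfolding 1 2 using nz w e by (simp add: field_simps)
  also have "\<dots> = wp_cert A \<alpha> \<gamma> m (Suc j) - wp_cert A \<alpha> \<gamma> m j"
    unfolding 3 4 b_addition using nz w e by (simp add: field_simps)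
  finally show ?thesis .
qed

text \<open>Induction on m with \<gamma> fixed: summing \<open>wp_cert_step\<close> over j gives a
  first-order recursion, and the right-hand side obeys the same one, with ratio b (\<alpha> +
  \<gamma> - m) / b (m + 1).\<close>

lemma wp_sum:
  assumes A: "\<And>i::nat. b (A + of_nat i) \<noteq> 0"
  shows "(\<Sum>j\<le>m. wp_term A \<alpha> \<gamma> m j) = poch (\<alpha> + \<gamma> + 1 - of_nat m) m / poch 1 m"
proof (induction m)
  case 0
  show ?case using A[of 0] by (simp add: wp_term_def poch_Suc)
next
  case (Suc m)
  let ?B = "b (of_nat m + 1)" and ?C = "b (\<alpha> + \<gamma> - of_nat m)"
  have B: "?B \<noteq> 0" using b_of_nat_nonzero[of "Suc m"] by (simp add: add.commute)
  have "(\<Sum>j\<le>m. ?B * wp_term A \<alpha> \<gamma> (Suc m) j - ?C * wp_term A \<alpha> \<gamma> m j)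
      = (\<Sum>j<Suc m. wp_cert A \<alpha> \<gamma> m (Suc j) - wp_cert A \<alpha> \<gamma> m j)"
    by (intro sum.cong) (auto simp: wp_cert_step[OF A] lessThan_Suc_atMost)
  also have "\<dots> = wp_cert A \<alpha> \<gamma> m (Suc m)"
    by (simp only: sum_lessThan_telescope) (simp add: wp_cert_def)
  \<comment> \<open>The boundary value supplies precisely the term j = m + 1 missing from the sum:
    its factor b (A + 2 (m + 1)) cancels against the last factor of
    \<open>poch (A + of_nat (Suc m)) (Suc (Suc m))\<close>.\<close>
  also have "\<dots> = - (?B * wp_term A \<alpha> \<gamma> (Suc m) (Suc m))"
    using A[of "Suc m + Suc m"] B
    by (simp add: wp_cert_def wp_term_def poch_Suc[of _ "Suc m"] algebra_simps)
  finally have "?B * (\<Sum>j\<le>Suc m. wp_term A \<alpha> \<gamma> (Suc m) j) = ?C * (\<Sum>j\<le>m. wp_term A \<alpha> \<gamma> m j)"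
    by (simp add: sum_subtractf sum_distrib_left algebra_simps)
  also have "\<dots> = poch (\<alpha> + \<gamma> + 1 - of_nat (Suc m)) (Suc m) / poch 1 m"
    unfolding Suc by (simp add: poch_Suc_left[of _ m] algebra_simps)
  finally show ?case
    using B by (simp add: poch_Suc[of 1] field_simps)
qed

end

section \<open>The four-term relation for hyperbolic sines\<close>

lemma exp_addition:
  fixes h :: complex
  defines "E \<equiv> \<lambda>s. exp (s * h) - exp (- s * h)"
  shows "E (m + 1) * E (\<gamma> - m - 1) * E (A + m - \<alpha>) * E (A + 2 * j)
          - E (\<alpha> + \<gamma> - m) * E (A + 2 * j) * E (m + 1 - j) * E (A + j + m + 1)
        = E j * E (A + j + m + 1) * E (\<gamma> - j) * E (A + j - 1 - \<alpha>)
          - E (A + \<gamma> + j) * E (\<alpha> + 1 + j) * E (m + 1 - j) * E (A + j)"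
proof -
  text \<open>In terms of the even function \<open>C\<close>, products of four \<open>E\<close> become sums of \<open>C\<close>.\<close>
  define C where "C s = exp (s * h) + exp (- s * h)" for s
  have EE: "E u * E v = C (u + v) - C (u - v)" for u v
    unfolding E_def C_def by (simp add: algebra_simps flip: exp_add)
  have CC: "C u * C v = C (u + v) + C (u - v)" for u v
    unfolding C_def by (simp add: algebra_simps flip: exp_add)
  have EEEE: "E u * E v * E w * E x = (C (u+v+(w+x)) + C (u+v-(w+x)) - C (u+v+(w-x)) - C (u+v-(w-x)))
    - (C (u-v+(w+x)) + C (u-v-(w+x)) - C (u-v+(w-x)) - C (u-v-(w-x)))" for u v w x
  proof -
    have "E u * E v * E w * E x = (E u * E v) * (E w * E x)" by (simp add: ac_simps)
    also have "\<dots> = (C (u+v) - C (u-v)) * (C (w+x) - C (w-x))" by (simp only: EE)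
    also have "\<dots> = C (u+v) * C (w+x) - C (u+v) * C (w-x) - (C (u-v) * C (w+x) - C (u-v) * C (w-x))"
      by (simp only: left_diff_distrib right_diff_distrib) simp
    finally show ?thesis by (simp only: CC) simp
  qed
  \<comment> \<open>With \<open>C\<close> unfolded, C u and C (- u) differ only in the order of
    their summands, so the expanded sums on both sides match.\<close>
  show ?thesis unfolding EEEE C_def by (simp add: algebra_simps)
qed

section \<open>Gamma functions attached to a bracket, and the Beta sum\<close>

locale bracket_gamma = bracket +
  fixes G :: "complex \<Rightarrow> complex"
  assumes inverse_G: "inverse (G s) = b s * inverse (G (s + 1))"
    and G_1: "G 1 = 1"
begin

text \<open>Working with reciprocals keeps the recursion valid at poles, where G has the value 0 and
  1/G is correctly 0. The form G (s + 1) = b s * G s would fail at s = 0.\<close>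

lemma inverse_G_poch: "inverse (G s) = poch s m * inverse (G (s + of_nat m))"
proof (induction m)
  case (Suc m)
  then show ?case
    using inverse_G[of "s + of_nat m"] by (simp add: poch_Suc algebra_simps)
qed simp

lemma G_nonzero_add: "G s \<noteq> 0 \<Longrightarrow> G (s + of_nat m) \<noteq> 0"
  using inverse_G_poch[of s m] by auto

lemma b_nonzero_add: "G s \<noteq> 0 \<Longrightarrow> b (s + of_nat m) \<noteq> 0"
  using G_nonzero_add[of s m] inverse_G[of "s + of_nat m"] by auto

text \<open>Finiteness is required only at s + m: if s is a pole, the quotient is 0 by convention,
  and \<open>poch s m\<close> vanishes too because the reciprocal at s + m is nonzero.\<close>

lemma G_div_G: "G (s + of_nat m) \<noteq> 0 \<Longrightarrow> G (s + of_nat m) / G s = poch s m"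
  using inverse_G_poch[of s m] by (simp add: field_simps)

lemma G_of_nat: "G (of_nat m + 1) = poch 1 m"
  using inverse_G_poch[of 1 m] by (auto simp: G_1 field_simps)

text \<open>Here w stands for 2a + c. With n = m + 1 and k = j + 1, the summand is a factor K
  independent of j times \<open>wp_term\<close> with A = w + 2 and \<gamma> = \<beta> + m.\<close>

lemma beta_sum:
  assumes fin: "\<And>k::nat. k \<in> {1..n} \<Longrightarrow> G (of_nat n - of_nat k + \<beta>) \<noteq> 0 \<and>
      G (w + of_nat n + of_nat k + \<beta>) \<noteq> 0 \<and> G (of_nat k + \<alpha>) \<noteq> 0 \<and> G (w + of_nat k + 1) \<noteq> 0"
    and fin': "G (of_nat n + \<alpha> + \<beta>) \<noteq> 0" "G (w + of_nat n + \<beta> + 1) \<noteq> 0"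
    and "n > 0"
  shows "(\<Sum>k=1..n.
      G (of_nat n - of_nat k + \<beta>) * G (w + of_nat n + of_nat k + \<beta>) /
      (G (of_nat n - of_nat k + 1) * G (w + of_nat n + of_nat k + 1)) / G \<beta> *
      (G (of_nat k + \<alpha>) * G (w + of_nat k + 1) /
      (G (of_nat k) * G (w + of_nat k - \<alpha> + 1)) / G (\<alpha> + 1)) * b (w + 2 * of_nat k))
    = G (of_nat n + \<alpha> + \<beta>) * G (w + of_nat n + \<beta> + 1) /
      (G (of_nat n) * G (w + of_nat n - \<alpha> + 1)) / G (\<alpha> + \<beta> + 1)"
    (is "sum ?t _ = ?r")
proof -
  obtain m where n: "n = Suc m" using \<open>n > 0\<close> gr0_conv_Suc by auto
  define K where "K = G (w + of_nat n + \<beta> + 1) / G (w + of_nat n - \<alpha> + 1)"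
  \<comment> \<open>The hypothesis at k = 1. By the recursion it makes every b (w + 2 + i) nonzero,
    as \<open>wp_sum\<close> requires.\<close>
  have w2: "G (w + 2) \<noteq> 0" using fin[of 1] n by (simp add: add.assoc)
  have A: "b (w + 2 + of_nat i) \<noteq> 0" for i
    by (rule b_nonzero_add[OF w2])
  have "?t (Suc j) = K * wp_term (w + 2) \<alpha> (\<beta> + of_nat m) m j" if "j \<le> m" for j
  proof -
    obtain d where m: "m = j + d" using \<open>j \<le> m\<close> le_Suc_ex by blast
    note f = fin[of "Suc j"]
    have 1: "G (of_nat n - of_nat (Suc j) + \<beta>) / G \<beta> = poch \<beta> (m - j)"
      using G_div_G[of \<beta> d] f by (simp add: n m add.commute)
    have 2: "G (w + of_nat n + of_nat (Suc j) + \<beta>) = poch (w + 2 + (\<beta> + of_nat m)) j * G (w + of_nat n + \<beta> + 1)"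
      using G_div_G[of "w + of_nat n + \<beta> + 1" j] f fin' by (simp add: n m algebra_simps nonzero_divide_eq_eq)
    have 3: "G (of_nat n - of_nat (Suc j) + 1) = poch 1 (m - j)"
      using G_of_nat[of d] by (simp add: n m)
    have 4: "G (w + of_nat (Suc j) + 1) / G (w + of_nat n + of_nat (Suc j) + 1) = 1 / poch (w + 2 + of_nat j) (Suc m)"
      using G_div_G[of "w + 2 + of_nat j" "Suc m"] G_nonzero_add[OF w2, of "j + Suc m"]
         G_nonzero_add[OF w2, of "j"]
      by (simp add: n add_ac) (simp add: field_simps)
    have 5: "G (of_nat (Suc j) + \<alpha>) / G (\<alpha> + 1) = poch (\<alpha> + 1) j"
      using G_div_G[of "\<alpha> + 1" j] f n m by (simp add: add_ac)
    have 6: "G (of_nat (Suc j)) = poch 1 j"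
      using G_of_nat[of j] by (simp add: add_ac)
    \<comment> \<open>No finiteness is known for these denominator values, so the reciprocal
      recursion is used; it also covers poles.\<close>
    have 7: "1 / G (w + of_nat (Suc j) - \<alpha> + 1) = poch (w + 2 + of_nat j - \<alpha>) (m - j) / G (w + of_nat n - \<alpha> + 1)"
      using inverse_G_poch[of "w + 2 + of_nat j - \<alpha>" d] by (simp add: n m algebra_simps inverse_eq_divide)
    have "?t (Suc j) = (G (of_nat n - of_nat (Suc j) + \<beta>) / G \<beta>) * G (w + of_nat n + of_nat (Suc j) + \<beta>) *
      (1 / G (of_nat n - of_nat (Suc j) + 1)) * (G (w + of_nat (Suc j) + 1) / G (w + of_nat n + of_nat (Suc j) + 1)) *
      (G (of_nat (Suc j) + \<alpha>) / G (\<alpha> + 1)) * (1 / G (of_nat (Suc j))) * (1 / G (w + of_nat (Suc j) - \<alpha> + 1)) *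
      b (w + 2 * of_nat (Suc j))"
      by (simp add: divide_inverse ac_simps)
    also have "\<dots> = K * wp_term (w + 2) \<alpha> (\<beta> + of_nat m) m j"
      unfolding 1 2 3 4 5 6 7 wp_term_def K_def by (simp add: divide_inverse algebra_simps)
    finally show ?thesis .
  qed
  note t = this
  have "sum ?t {1..n} = (\<Sum>j\<le>m. ?t (Suc j))"
    unfolding n by (simp only: One_nat_def sum.atLeast_Suc_atMost_Suc_shift atLeast0AtMost o_def)
  also have "\<dots> = K * (\<Sum>j\<le>m. wp_term (w + 2) \<alpha> (\<beta> + of_nat m) m j)"
    unfolding sum_distrib_left by (intro sum.cong t) auto
  \<comment> \<open>Since \<gamma> = \<beta> + m, the base \<alpha> + \<gamma> + 1 - m is \<alpha> +
    \<beta> + 1.\<close>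
  also have "\<dots> = K * (poch (\<alpha> + \<beta> + 1) m / poch 1 m)"
    by (subst wp_sum[OF A]) (simp add: algebra_simps)
  also have "poch (\<alpha> + \<beta> + 1) m = G (of_nat n + \<alpha> + \<beta>) / G (\<alpha> + \<beta> + 1)"
    using G_div_G[of "\<alpha> + \<beta> + 1" m] fin' by (simp add: n add_ac)
  also have "poch 1 m = G (of_nat n)"
    using G_of_nat[of m] by (simp add: n add.commute)
  finally show ?thesis
    by (simp add: K_def divide_inverse ac_simps)
qed

end

section \<open>The brackets of the two lattices\<close>

fun lattice_bracket :: "lattice \<Rightarrow> complex \<Rightarrow> complex" where
  "lattice_bracket (Quad c1 c2 c3 l) s = s"
| "lattice_bracket (Expo c1 c2 c3 q lq lc lp lr) s =
     (exp (s * (lq / 2)) - exp (- s * (lq / 2))) / (exp (lq / 2) - exp (- (lq / 2)))"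

text \<open>A logarithm of the constant $C$.\<close>

fun lattice_log :: "lattice \<Rightarrow> complex" where
  "lattice_log (Quad c1 c2 c3 l) = l"
| "lattice_log (Expo c1 c2 c3 q lq lc lp lr) = lp + lc / 2 - lq"

lemma exp_half_diff:
  fixes s h :: complex
  shows "exp (s * (h / 2)) - exp (- s * (h / 2)) = exp (- s * (h / 2)) * (exp (s * h) - 1)"
proof -
  have "exp (- s * (h / 2)) * exp (s * h) = exp (s * (h / 2))"
    unfolding exp_add[symmetric] by (simp add: field_simps)
  then show ?thesis by (simp add: right_diff_distrib)
qed

lemma bracket_lattice:
  assumes "nonuniform_lattice X"
  shows "bracket (lattice_bracket X)"
proof (cases X)
  case (Quad c1 c2 c3 l)
  then have id: "lattice_bracket X = (\<lambda>s. s)" by auto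
  show ?thesis unfolding id by unfold_locales (simp_all, algebra)
next
  case (Expo c1 c2 c3 q lq lc lp lr)
  have q: "exp lq = q" "norm q \<noteq> 1" "q \<noteq> 0" using assms Expo by auto
  define E where "E s = exp (s * (lq / 2)) - exp (- s * (lq / 2))" for s
  have X: "lattice_bracket X s = E s / E 1" for s by (simp add: E_def Expo)
  \<comment> \<open>A zero would give q^m = 1, contradicting |q| \<noteq> 1.\<close>
  have nz: "E (of_nat m) \<noteq> 0" if "m > 0" for m
  proof -
    have "exp (of_nat m * lq) = q ^ m" by (simp add: exp_of_nat_mult q)
    moreover have "q ^ m \<noteq> 1"
      using q that by (metis norm_ge_zero norm_one norm_power power_eq_1_iff neq0_conv)
    ultimately show ?thesis unfolding E_def exp_half_diff by simp
  qed
  have 1: "E 1 \<noteq> 0" using nz[of 1] by simp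
  show ?thesis
  proof
    show "lattice_bracket X 0 = 0" by (simp add: X E_def)
    show "lattice_bracket X (of_nat m) \<noteq> 0" if "m > 0" for m
      using nz[OF that] 1 by (simp add: X)
  next
    fix m \<gamma> A \<alpha> j :: complex
    \<comment> \<open>Every product in the relation has four factors, so the normalisation by
      \<open>E 1\<close> leaves a common denominator.\<close>
    note exp_addition[of m "lq / 2" \<gamma> A \<alpha> j, folded E_def]
    then show "lattice_bracket X (m + 1) * lattice_bracket X (\<gamma> - m - 1) * lattice_bracket X (A + m - \<alpha>) * lattice_bracket X (A + 2 * j)
          - lattice_bracket X (\<alpha> + \<gamma> - m) * lattice_bracket X (A + 2 * j) * lattice_bracket X (m + 1 - j) * lattice_bracket X (A + j + m + 1)
        = lattice_bracket X j * lattice_bracket X (A + j + m + 1) * lattice_bracket X (\<gamma> - j) * lattice_bracket X (A + j - 1 - \<alpha>)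
          - lattice_bracket X (A + \<gamma> + j) * lattice_bracket X (\<alpha> + 1 + j) * lattice_bracket X (m + 1 - j) * lattice_bracket X (A + j)"
      by (simp add: X flip: diff_divide_distrib)
  qed
qed

section \<open>The q-Gamma function and its symmetric normalisation\<close>

lemma convergent_prod_one_minus_exp:
  fixes h s :: complex
  assumes "norm (exp h) < 1"
  shows "convergent_prod (\<lambda>k::nat. 1 - exp ((s + of_nat k) * h))"
proof -
  have "summable (\<lambda>k. norm (exp (s * h)) * norm (exp h) ^ k)"
    using assms by (intro summable_mult summable_geometric) auto
  also have "(\<lambda>k. norm (exp (s * h)) * norm (exp h) ^ k) = (\<lambda>k. norm (1 - exp ((s + of_nat k) * h) - 1))"
    by (auto simp: ring_distribs exp_add exp_of_nat_mult norm_mult norm_power simp del: norm_exp_eq_Re)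
  finally show ?thesis
    by (intro abs_convergent_prod_imp_convergent_prod summable_imp_abs_convergent_prod)
qed

lemma exp_Suc_mult_neq_1:
  fixes h :: complex
  assumes "norm (exp h) < 1"
  shows "exp ((1 + of_nat k) * h) \<noteq> 1"
proof
  assume "exp ((1 + of_nat k) * h) = 1"
  then have "norm (exp ((1 + of_nat k) * h)) = 1" by (simp only: norm_one)
  then show False using assms by simp
qed

lemma qGamma_inner_rec:
  assumes "norm (exp h) < 1" "exp r = 1 - exp h"
  shows "inverse (qGamma_inner h r s) = (1 - exp (s * h)) / (1 - exp h) * inverse (qGamma_inner h r (s + 1))"
proof -
  have "(\<Prod>k. 1 - exp ((s + of_nat k) * h)) = (1 - exp (s * h)) * (\<Prod>k. 1 - exp ((s + of_nat (Suc k)) * h))"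
  proof -
    have "convergent_prod (\<lambda>k. 1 - exp ((s + of_nat k) * h))" by (rule convergent_prod_one_minus_exp[OF assms(1)])
    \<comment> \<open>The split-off factor k = 0 may itself vanish; the splitting remains valid
      then.\<close>
    then have "(\<lambda>k. 1 - exp ((s + of_nat k) * h)) has_prod
       ((\<Prod>k<1::nat. 1 - exp ((s + of_nat k) * h)) * (\<Prod>k. 1 - exp ((s + of_nat (k + 1)) * h)))"
      by (rule has_prod_ignore_initial_segment')
    then show ?thesis by (simp add: has_prod_iff)
  qed
  moreover have "exp ((s + 1 - 1) * r) = exp ((s - 1) * r) * (1 - exp h)"
    by (simp add: assms(2)[symmetric] algebra_simps flip: exp_add)
  moreover have "1 - exp h \<noteq> 0" using exp_Suc_mult_neq_1[OF assms(1), of 0] by simp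
  ultimately show ?thesis
    by (simp add: qGamma_inner_def add_ac)
qed

lemma qGamma_inner_nonzero:
  assumes h: "norm (exp h) < 1" and s: "\<And>k::nat. exp ((s + of_nat k) * h) \<noteq> 1"
  shows "qGamma_inner h r s \<noteq> 0"
proof -
  have "(\<Prod>k. 1 - exp ((1 + of_nat k) * h)) \<noteq> 0"
    using exp_Suc_mult_neq_1[OF h] by (intro prodinf_nonzero convergent_prod_one_minus_exp h) auto
  moreover have "(\<Prod>k. 1 - exp ((s + of_nat k) * h)) \<noteq> 0"
    using s by (intro prodinf_nonzero convergent_prod_one_minus_exp h) (metis eq_iff_diff_eq_0)
  ultimately show ?thesis
    by (simp add: qGamma_inner_def add_ac)
qed

lemma qGamma_inner_1:
  assumes "norm (exp h) < 1"
  shows "qGamma_inner h r 1 = 1"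
proof -
  have "qGamma_inner h r 1 \<noteq> 0"
    by (rule qGamma_inner_nonzero[OF assms exp_Suc_mult_neq_1[OF assms]])
  moreover have "qGamma_inner h r 1 = P / P" if "P = (\<Prod>k. 1 - exp ((1 + of_nat k) * h))" for P
    by (simp add: qGamma_inner_def that add_ac)
  \<comment> \<open>The two infinite products coincide at s = 1; nonvanishing rules out the case 0 /
    0 = 0.\<close>
  ultimately show ?thesis by (metis div_by_0 div_self)
qed

text \<open>The prefactor q^(-(s-1)(s-2)/4) turns the asymmetric ratio (1 - q^s) / (1 - q) in the
  recursion of \<open>qGamma\<close> into the symmetric bracket, which is q^((1-s)/2) times that
  ratio.\<close>

lemma bracket_Gamma_lattice:
  assumes "nonuniform_lattice X"
  shows "bracket_gamma (lattice_bracket X) (bracket_Gamma X)"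
proof -
  interpret bracket "lattice_bracket X" by (rule bracket_lattice[OF assms])
  have *: "inverse (bracket_Gamma X s) = lattice_bracket X s * inverse (bracket_Gamma X (s + 1)) \<and>
     bracket_Gamma X 1 = 1" for s
  proof (cases X)
    case (Quad c1 c2 c3 l)
    show ?thesis
      using rGamma_plus1[of s] by (simp add: Quad rGamma_inverse_Gamma[symmetric])
  next
    case (Expo c1 c2 c3 q lq lc lp lr)
    have q: "exp lq = q" "norm q \<noteq> 1" "q \<noteq> 0"
      "exp lr = 1 - (if norm q < 1 then q else 1 / q)" using assms Expo by auto
    have rec: "inverse (qGamma lq lr s) = (1 - exp (s * lq)) / (1 - exp lq) * inverse (qGamma lq lr (s + 1))
        \<and> qGamma lq lr 1 = 1"
    proof (cases "norm (exp lq) < 1")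
      case True
      then show ?thesis
        using q qGamma_inner_rec[of lq lr s] qGamma_inner_1[of lq lr]
        unfolding qGamma_def by (simp del: norm_exp_eq_Re)
    next
      case False
      then have *: "norm (exp (- lq)) < 1" "exp lr = 1 - exp (- lq)"
        using q by (auto simp: norm_exp_eq_Re[symmetric] exp_minus norm_divide norm_inverse divide_simps simp del: norm_exp_eq_Re)
      \<comment> \<open>Passing from s to s + 1 changes q^((s-1)(s-2)/2) by q^(s-1), which is what
        separates the ratio for 1/q from the ratio for q. Hence |q| > 1 obeys the same
        recursion.\<close>
      have 1: "exp (- ((s - 1) * (s - 2) / 2 * lq)) * ((1 - exp (s * - lq)) / (1 - exp (- lq))) =
          (1 - exp (s * lq)) / (1 - exp lq) * exp (- ((s + 1 - 1) * (s + 1 - 2) / 2 * lq))"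
      proof -
        have nz: "1 - exp (- lq) \<noteq> 0" "1 - exp lq \<noteq> 0"
          using * q by auto
        have e: "exp (- ((s - 1) * (s - 2) / 2 * lq)) = exp (- ((s + 1 - 1) * (s + 1 - 2) / 2 * lq)) * exp (s * lq) / exp lq"
          unfolding exp_add[symmetric] exp_diff[symmetric]
          by (rule arg_cong[where f = exp]) (simp add: field_simps)
        have "u * x / y * ((1 - inverse x) / (1 - inverse y)) = (1 - x) / (1 - y) * u"
          if "x \<noteq> 0" "y \<noteq> 0" "1 - inverse y \<noteq> 0" "1 - y \<noteq> 0" for u x y :: complex
          using that by (simp add: divide_simps) (simp add: algebra_simps)
        then show ?thesis
          unfolding e mult_minus_right exp_minus[of lq] exp_minus[of "s * lq"]
          using nz by (simp only: exp_not_eq_zero exp_minus not_False_eq_True)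
      qed
      have "inverse (qGamma lq lr s) =
          (exp (- ((s - 1) * (s - 2) / 2 * lq)) * ((1 - exp (s * - lq)) / (1 - exp (- lq)))) *
            inverse (qGamma_inner (- lq) lr (s + 1))"
        using False qGamma_inner_rec[OF *, of s] by (simp add: qGamma_def exp_minus)
      also have "\<dots> = (1 - exp (s * lq)) / (1 - exp lq) * inverse (qGamma lq lr (s + 1))"
        unfolding 1 using False by (simp add: qGamma_def exp_minus)
      finally show ?thesis
        using False qGamma_inner_1[OF *(1), of lr] by (simp add: qGamma_def)
    qed
    have nz: "1 - exp lq \<noteq> 0" using q by auto
    have b: "lattice_bracket X s = exp ((1 - s) / 2 * lq) * ((1 - exp (s * lq)) / (1 - exp lq))"
    proof -
      have "lattice_bracket X s = (exp (- s * (lq / 2)) * (exp (s * lq) - 1)) / (exp (- 1 * (lq / 2)) * (exp (1 * lq) - 1))"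
        using exp_half_diff[of s lq] exp_half_diff[of 1 lq] by (simp add: Expo)
      also have "\<dots> = exp (- s * (lq / 2) - - 1 * (lq / 2)) * ((exp (s * lq) - 1) / (exp lq - 1))"
        unfolding exp_diff by simp
      also have "(exp (s * lq) - 1) / (exp lq - 1) = (1 - exp (s * lq)) / (1 - exp lq)"
        by (metis minus_diff_eq minus_divide_divide)
      also have "- s * (lq / 2) - - 1 * (lq / 2) = (1 - s) / 2 * lq"
        by (simp add: field_simps)
      finally show ?thesis .
    qed
    have e: "inverse (exp (- ((s - 1) * (s - 2) / 4) * lq)) =
       exp ((1 - s) / 2 * lq) * inverse (exp (- ((s + 1 - 1) * (s + 1 - 2) / 4) * lq))"
      unfolding exp_minus[symmetric] exp_add[symmetric]
      by (rule arg_cong[where f = exp]) (simp add: field_simps)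
    have "inverse (bracket_Gamma X s) =
        lattice_bracket X s * inverse (bracket_Gamma X (s + 1))"
      unfolding b[unfolded Expo] Expo bracket_Gamma.simps inverse_mult_distrib e rec[THEN conjunct1] by (simp only: mult_ac)
    then show ?thesis
      using rec by (simp add: Expo)
  qed
  show ?thesis
    by unfold_locales (rule *[THEN conjunct1], rule *[THEN conjunct2])
qed

text \<open>Neither Gamma function has genuine zeros; the value 0 only encodes a pole. This turns
  the finiteness conditions into the nonvanishing that \<open>beta_sum\<close> needs.\<close>

lemma bracket_Gamma_nonzero:
  assumes "nonuniform_lattice X" "Gamma_finite X s"
  shows "bracket_Gamma X s \<noteq> 0"
proof (cases X)
  case (Quad c1 c2 c3 l)
  then show ?thesis using assms by (simp add: Gamma_eq_zero_iff)
next
  case (Expo c1 c2 c3 q lq lc lp lr)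
  have s: "exp ((s + of_nat k) * lq) \<noteq> 1" for k using assms Expo by simp
  have "qGamma lq lr s \<noteq> 0"
  proof (cases "norm (exp lq) < 1")
    case True
    then show ?thesis using qGamma_inner_nonzero[OF _ s] by (simp add: qGamma_def)
  next
    case False
    moreover have "norm (exp lq) \<noteq> 1" using assms Expo by (auto simp del: norm_exp_eq_Re)
    ultimately have "norm (exp (- lq)) < 1" by simp
    moreover have "exp ((s + of_nat k) * - lq) \<noteq> 1" for k
      using s[of k] by (simp add: exp_minus)
    ultimately show ?thesis
      using False qGamma_inner_nonzero[of "- lq" s] by (simp add: qGamma_def)
  qed
  then show ?thesis by (simp add: Expo)
qed

section \<open>Generalized powers and the lattice difference in terms of brackets\<close>

lemma gen_power_bracket:
  assumes "nonuniform_lattice X"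
  shows "gen_power X S Z \<mu> = exp (\<mu> * lattice_log X) *
    (bracket_Gamma X (S - Z + \<mu>) * bracket_Gamma X (S + Z + lattice_c X + 1) /
     (bracket_Gamma X (S - Z) * bracket_Gamma X (S + Z - \<mu> + lattice_c X + 1)))"
proof (cases X)
  case (Quad c1 c2 c3 l)
  then show ?thesis by (simp add: Let_def)
next
  case (Expo c1 c2 c3 q lq lc lp lr)
  have lq: "lq \<noteq> 0" using assms Expo by auto
  define c where "c = lc / lq"
  define f where "f s = - ((s - 1) * (s - 2) / 4) * lq" for s :: complex
  have lc: "lc = c * lq" using lq by (simp add: c_def)
  \<comment> \<open>In the quotient of the four prefactors the quadratic exponents combine to -\<mu>
    S - \<mu> c / 2 + \<mu> times \<open>lq\<close>. The first part is the factor q^(-\<mu> S), and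
    the rest explains the summands lc / 2 - lq of \<open>lattice_log\<close>.\<close>
  have "exp (\<mu> * lp) * exp (- \<mu> * S * lq) =
     exp (\<mu> * lattice_log X) * (exp (f (S - Z + \<mu>)) * exp (f (S + Z + c + 1)) /
       (exp (f (S - Z)) * exp (f (S + Z - \<mu> + c + 1))))"
    unfolding exp_add[symmetric] exp_diff[symmetric] Expo lattice_log.simps lc f_def
    by (rule arg_cong[where f = exp]) (simp add: field_simps)
  then show ?thesis
    unfolding Expo gen_power.simps bracket_Gamma.simps lattice_c.simps Let_def c_def[symmetric] f_def[symmetric]
    by (simp only: divide_inverse inverse_mult_distrib mult_ac)
qed

lemma nabla_shifted_bracket:
  assumes "nonuniform_lattice X"
  shows "nabla (shifted X 1) t = exp (lattice_log X) * lattice_bracket X (2 * t + lattice_c X)"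
proof (cases X)
  case (Quad c1 c2 c3 l)
  then have "exp l = c1" "c1 \<noteq> 0" using assms by auto
  then show ?thesis
    by (simp add: Quad nabla_def shifted_def power2_eq_square field_simps)
next
  case (Expo c1 c2 c3 q lq lc lp lr)
  have q: "exp lq = q" "q \<noteq> 1" "exp lc = c1 / c2" "c2 \<noteq> 0" "exp lp = c2 * (1 - q)\<^sup>2"
    using assms Expo by auto
  have lq: "lq \<noteq> 0" using q by auto
  \<comment> \<open>With h = q^(1/2), y = q^t and m = (c1 / c2)^(1/2), the claim is a rational
    identity. The roots come from halving the chosen logarithms, so they agree with the branches in
    the bracket and in \<open>lattice_log\<close>.\<close>
  define h where "h = exp (lq / 2)"
  define y where "y = exp (t * lq)"
  define m where "m = exp (lc / 2)"
  have nz: "h \<noteq> 0" "y \<noteq> 0" "m \<noteq> 0" by (auto simp: h_def y_def m_def)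
  have qh: "q = h ^ 2" unfolding q(1)[symmetric] h_def by (simp flip: exp_double)
  have hh: "h ^ 2 - 1 \<noteq> 0" using q qh by auto
  have c1: "c1 = m ^ 2 * c2" using q unfolding m_def by (simp flip: exp_double)
  have L: "exp (lattice_log X) = c2 * (1 - h ^ 2) ^ 2 * m / h ^ 2"
    unfolding Expo lattice_log.simps exp_diff exp_add q qh m_def by simp
  have e: "exp ((2 * t + lc / lq) * (lq / 2)) = y * m" "exp (- (2 * t + lc / lq) * (lq / 2)) = 1 / (y * m)"
    proof -
    have "(2 * t + lc / lq) * (lq / 2) = t * lq + lc / 2" using lq by (simp add: field_simps)
    then show "exp ((2 * t + lc / lq) * (lq / 2)) = y * m" "exp (- (2 * t + lc / lq) * (lq / 2)) = 1 / (y * m)"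
      by (simp_all only: y_def m_def exp_add exp_minus mult_minus_left inverse_eq_divide)
  qed
  have B: "lattice_bracket X (2 * t + lattice_c X) = (y * m - 1 / (y * m)) / (h - 1 / h)"
    unfolding Expo lattice_bracket.simps lattice_c.simps e by (simp add: h_def exp_minus inverse_eq_divide)
  have x: "exp ((t + 1 / 2) * lq) = y * h" "exp (- (t + 1 / 2) * lq) = 1 / (y * h)"
     "exp ((t - 1 + 1 / 2) * lq) = y / h" "exp (- (t - 1 + 1 / 2) * lq) = h / y"
  proof -
    have "(t + 1 / 2) * lq = t * lq + lq / 2" "- (t + 1 / 2) * lq = - (t * lq + lq / 2)"
      "(t - 1 + 1 / 2) * lq = t * lq - lq / 2" "- (t - 1 + 1 / 2) * lq = lq / 2 - t * lq"
      by (simp_all add: field_simps)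
    then show "exp ((t + 1 / 2) * lq) = y * h" "exp (- (t + 1 / 2) * lq) = 1 / (y * h)"
      "exp ((t - 1 + 1 / 2) * lq) = y / h" "exp (- (t - 1 + 1 / 2) * lq) = h / y"
      by (simp_all only: y_def h_def exp_add exp_diff exp_minus inverse_eq_divide)
  qed
  have "nabla (shifted X 1) t = c1 * (y * h - y / h) + c2 * (1 / (y * h) - h / y)"
    unfolding nabla_def shifted_def Expo lattice_fun.simps x by (simp add: algebra_simps)
  also have "\<dots> = exp (lattice_log X) * lattice_bracket X (2 * t + lattice_c X)"
  proof -
    have "(y * m - 1 / (y * m)) / (h - 1 / h) = h * (y ^ 2 * m ^ 2 - 1) / (y * m * (h ^ 2 - 1))"
      using nz hh by (simp add: power2_eq_square divide_simps)
    moreover have "c2 * p ^ 2 * m / h ^ 2 * (h * N / (y * m * p)) = c2 * p * N / (y * h)" if "p \<noteq> 0" for p N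
      using nz that by (simp add: power2_eq_square divide_simps)
    ultimately have "exp (lattice_log X) * lattice_bracket X (2 * t + lattice_c X)
        = c2 * (h ^ 2 - 1) * (y ^ 2 * m ^ 2 - 1) / (y * h)"
      unfolding L B power2_commute[of 1 "h ^ 2"] using hh by simp
    moreover have "c1 * (y * h - y / h) + c2 * (1 / (y * h) - h / y)
        = c2 * (h ^ 2 - 1) * (y ^ 2 * m ^ 2 - 1) / (y * h)"
      unfolding c1 using nz by (simp add: power2_eq_square field_simps)
    ultimately show ?thesis by simp
  qed
  finally show ?thesis .
qed

section \<open>The Beta formula on the lattice\<close>

theorem theorem13:
  fixes X :: lattice and \<alpha> \<beta> a z :: complex and n :: nat
  assumes "nonuniform_lattice X"
    and "n > 0" and "z - a = of_nat n"
    and "\<And>k t. k \<in> {1..n} \<Longrightarrow> t = a + of_nat k \<Longrightarrow>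
           power_finite X \<beta> z \<beta> (t - 1) (\<beta> - 1) \<and> power_finite X 0 t 0 a \<alpha>"
    and "power_finite X \<beta> z \<beta> a (\<alpha> + \<beta>)"
  shows "(\<Sum>k=1..n. let t = a + of_nat k in
            shifted_power X \<beta> z \<beta> (t - 1) (\<beta> - 1) / bracket_Gamma X \<beta> *
            (shifted_power X 0 t 0 a \<alpha> / bracket_Gamma X (\<alpha> + 1)) *
            nabla (shifted X 1) t)
         = shifted_power X \<beta> z \<beta> a (\<alpha> + \<beta>) / bracket_Gamma X (\<alpha> + \<beta> + 1)"
proof -
  interpret bracket_gamma "lattice_bracket X" "bracket_Gamma X"
    by (rule bracket_Gamma_lattice[OF assms(1)])
  let ?G = "bracket_Gamma X" and ?L = "lattice_log X"
  define w where "w = 2 * a + lattice_c X"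
  have z: "z = a + of_nat n" using assms(3) by (simp add: algebra_simps)
  note power_bracket = shifted_power_def gen_power_bracket[OF assms(1)]
  \<comment> \<open>The shift \<beta> / 2 cancels in S - Z and adds \<beta> to S + Z; the lower
    point t - 1 accounts for the +1 in n - k + 1.\<close>
  have P1: "shifted_power X \<beta> z \<beta> (a + of_nat k - 1) (\<beta> - 1) = exp ((\<beta> - 1) * ?L) *
      (?G (of_nat n - of_nat k + \<beta>) * ?G (w + of_nat n + of_nat k + \<beta>) /
      (?G (of_nat n - of_nat k + 1) * ?G (w + of_nat n + of_nat k + 1)))" for k
    by (simp add: power_bracket z w_def algebra_simps)
  have P2: "shifted_power X 0 (a + of_nat k) 0 a \<alpha> = exp (\<alpha> * ?L) *
      (?G (of_nat k + \<alpha>) * ?G (w + of_nat k + 1) / (?G (of_nat k) * ?G (w + of_nat k - \<alpha> + 1)))" for k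
    by (simp add: power_bracket w_def algebra_simps)
  have P3: "shifted_power X \<beta> z \<beta> a (\<alpha> + \<beta>) = exp ((\<alpha> + \<beta>) * ?L) *
      (?G (of_nat n + \<alpha> + \<beta>) * ?G (w + of_nat n + \<beta> + 1) / (?G (of_nat n) * ?G (w + of_nat n - \<alpha> + 1)))"
    by (simp add: power_bracket z w_def algebra_simps)
  have N: "nabla (shifted X 1) (a + of_nat k) = exp ?L * lattice_bracket X (w + 2 * of_nat k)" for k
    by (simp add: nabla_shifted_bracket[OF assms(1)] w_def algebra_simps)
  \<comment> \<open>The powers of C match: \<beta> - 1 and \<alpha> from the generalized powers, and
    1 from \<open>nabla\<close>.\<close>
  have E: "exp ((\<beta> - 1) * ?L) * exp (\<alpha> * ?L) * exp ?L = exp ((\<alpha> + \<beta>) * ?L)"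
    by (simp add: algebra_simps flip: exp_add)
  have fin: "?G (of_nat n - of_nat k + \<beta>) \<noteq> 0 \<and> ?G (w + of_nat n + of_nat k + \<beta>) \<noteq> 0 \<and>
      ?G (of_nat k + \<alpha>) \<noteq> 0 \<and> ?G (w + of_nat k + 1) \<noteq> 0" if "k \<in> {1..n}" for k
    using assms(4)[OF that refl]
    by (intro conjI bracket_Gamma_nonzero[OF assms(1)])
       (simp_all add: power_finite_def Let_def z w_def algebra_simps)
  have fin': "?G (of_nat n + \<alpha> + \<beta>) \<noteq> 0" "?G (w + of_nat n + \<beta> + 1) \<noteq> 0"
    using assms(5)
    by (intro bracket_Gamma_nonzero[OF assms(1)]; simp add: power_finite_def Let_def z w_def algebra_simps)+
  have "(\<Sum>k=1..n. let t = a + of_nat k in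
            shifted_power X \<beta> z \<beta> (t - 1) (\<beta> - 1) / ?G \<beta> *
            (shifted_power X 0 t 0 a \<alpha> / ?G (\<alpha> + 1)) * nabla (shifted X 1) t)
      = exp ((\<alpha> + \<beta>) * ?L) * (\<Sum>k=1..n.
          ?G (of_nat n - of_nat k + \<beta>) * ?G (w + of_nat n + of_nat k + \<beta>) /
          (?G (of_nat n - of_nat k + 1) * ?G (w + of_nat n + of_nat k + 1)) / ?G \<beta> *
          (?G (of_nat k + \<alpha>) * ?G (w + of_nat k + 1) /
          (?G (of_nat k) * ?G (w + of_nat k - \<alpha> + 1)) / ?G (\<alpha> + 1)) *
          lattice_bracket X (w + 2 * of_nat k))"
    unfolding Let_def P1 P2 N E[symmetric] sum_distrib_left
    by (intro sum.cong refl) (simp only: divide_inverse mult_ac)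
  also have "\<dots> = shifted_power X \<beta> z \<beta> a (\<alpha> + \<beta>) / ?G (\<alpha> + \<beta> + 1)"
    by (subst beta_sum[OF fin fin' assms(2)]) (simp_all add: P3)
  finally show ?thesis .
qed

end
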